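(* Let $\omega\in\mathbb{R}^\ell$, let $A:\mathbb{T}^\ell\to GL(p,\mathbb{R})$, $B:\mathbb{T}^\ell\to \mathbb{R}^{q\times q}$ and $\eta:\mathbb{T}^\ell\to\mathbb{R}^{p\times q}$ be continuous, and suppose there is a constant $\kappa<1$ with $\|A^{-1}(\theta)\|\cdot\|B(\theta)\|\le\kappa$ for all $\theta\in\mathbb{T}^\ell$. Consider the equation $$A(\theta)\Delta(\theta)-\Delta(\theta+\omega)B(\theta)=\eta(\theta),\qquad \theta\in\mathbb{T}^\ell, \qquad (\ast)$$ for an unknown continuous $\Delta:\mathbb{T}^\ell\to\mathbb{R}^{p\times q}$. Define recursively, for $n\ge 0$, $$A_{n+1}^{-1}(\theta)=A_n^{-1}(\theta)A_n^{-1}(\theta+2^n\omega),\qquad B_{n+1}(\theta)=B_n(\theta+2^n\omega)B_n(\theta),$$ $$\eta_{n+1}(\theta)=\eta_n(\theta)+A_n^{-1}(\theta)\,\eta_n(\theta+2^n\omega)\,B_n(\theta),$$ with $A_0^{-1}=A^{-1}$, $B_0=B$, $\eta_0=A^{-1}\eta$. Then: (i) every continuous solution $\Delta$ of $(\ast)$ satisfies, for all $n\ge0$ and all $\theta\in\mathbb{T}^\ell$, $$\Delta(\theta)=\eta_{n+1}(\theta)+A_{n+1}^{-1}(\theta)\,\Delta(\theta+2^{n+1}\omega)\,B_{n+1}(\theta);$$ (ii) the sequence $(\eta_n)$ converges uniformly on $\mathbb{T}^\ell$, and $\Delta(\theta)=\lim_{n\to\infty}\eta_{n}(\theta)$ solves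 $(\ast)$; (iii) the convergence is superexponential in the number $n$ of iterations: for every $c>0$, $e^{cn}\sup_{\theta\in\mathbb{T}^\ell}\|\Delta(\theta)-\eta_n(\theta)\|\to0$ as $n\to\infty$.
   Context: $\mathbb{T}^\ell=\mathbb{R}^\ell/\mathbb{Z}^\ell$, and $\theta+\omega$ is understood modulo $\mathbb{Z}^\ell$. $\|\cdot\|$ denotes the Euclidean operator norm of a matrix. The symbol $A_n^{-1}$ denotes the matrix function produced by the recursion. *)

theory Defs
  imports "HOL-Analysis.Analysis"
begin

definition torus_rel :: "real ^ 'l \<Rightarrow> real ^ 'l \<Rightarrow> bool" where
  "torus_rel x y \<longleftrightarrow> (\<forall>i. x $ i - y $ i \<in> \<int>)"

lemma equivp_torus_rel: "equivp torus_rel"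
proof (rule equivpI)
  show "reflp torus_rel"
    by (auto simp: reflp_def torus_rel_def)
  show "symp torus_rel"
    unfolding symp_def torus_rel_def by (metis Ints_minus minus_diff_eq)
  show "transp torus_rel"
  proof (rule transpI, unfold torus_rel_def, rule allI)
    fix x y z :: "real ^ 'l" and i
    assume "\<forall>i. x $ i - y $ i \<in> \<int>" "\<forall>i. y $ i - z $ i \<in> \<int>"
    then have "(x $ i - y $ i) + (y $ i - z $ i) \<in> \<int>"
      by (blast intro: Ints_add)
    then show "x $ i - z $ i \<in> \<int>" by simp
  qed
qed

quotient_type 'l torus = "(real, 'l::finite) vec" / torus_rel
  by (rule equivp_torus_rel)

lift_definition to_torus :: "real ^ 'l \<Rightarrow> 'l::finite torus" is "\<lambda>x. x" .

instantiation torus :: (finite) ab_group_add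
begin

lift_definition zero_torus :: "'a torus" is 0 .

lift_definition plus_torus :: "'a torus \<Rightarrow> 'a torus \<Rightarrow> 'a torus" is "(+)"
  unfolding torus_rel_def
proof (rule allI)
  fix x y u v :: "real ^ 'a" and i
  assume "\<forall>i. x $ i - y $ i \<in> \<int>" "\<forall>i. u $ i - v $ i \<in> \<int>"
  then have "(x $ i - y $ i) + (u $ i - v $ i) \<in> \<int>"
    by (blast intro: Ints_add)
  then show "(x + u) $ i - (y + v) $ i \<in> \<int>" by (simp add: algebra_simps)
qed

lift_definition uminus_torus :: "'a torus \<Rightarrow> 'a torus" is uminus
  unfolding torus_rel_def
proof (rule allI)
  fix x y :: "real ^ 'a" and i
  assume "\<forall>i. x $ i - y $ i \<in> \<int>"
  then have "- (x $ i - y $ i) \<in> \<int>"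
    by (blast intro: Ints_minus)
  then show "(- x) $ i - (- y) $ i \<in> \<int>" by (simp add: algebra_simps)
qed

lift_definition minus_torus :: "'a torus \<Rightarrow> 'a torus \<Rightarrow> 'a torus" is "(-)"
  unfolding torus_rel_def
proof (rule allI)
  fix x y u v :: "real ^ 'a" and i
  assume "\<forall>i. x $ i - y $ i \<in> \<int>" "\<forall>i. u $ i - v $ i \<in> \<int>"
  then have "(x $ i - y $ i) - (u $ i - v $ i) \<in> \<int>"
    by (blast intro: Ints_diff)
  then show "(x - u) $ i - (y - v) $ i \<in> \<int>" by (simp add: algebra_simps)
qed

instance
  by standard (transfer; simp add: torus_rel_def)+

end

instantiation torus :: (finite) topological_space
begin

definition open_torus :: "'a torus set \<Rightarrow> bool" where
  "open_torus U \<longleftrightarrow> open (to_torus -` U)"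

instance
  by standard (auto simp: open_torus_def vimage_Union)

end

text \<open>
  The library's \<open>norm\<close> on matrices is the Frobenius norm, so the Euclidean operator norm is
  introduced separately.
\<close>

definition opnorm :: "real ^ 'n ^ 'm \<Rightarrow> real" where
  "opnorm M = onorm ((*v) M)"

primrec Ainv_iter ::
  "real ^ 'l \<Rightarrow> ('l torus \<Rightarrow> real ^ 'p ^ 'p) \<Rightarrow> nat \<Rightarrow> 'l torus \<Rightarrow> real ^ 'p ^ 'p" where
  "Ainv_iter \<omega> A 0 = (\<lambda>\<theta>. matrix_inv (A \<theta>))"
| "Ainv_iter \<omega> A (Suc n) =
     (\<lambda>\<theta>. Ainv_iter \<omega> A n \<theta> ** Ainv_iter \<omega> A n (\<theta> + to_torus (2 ^ n *\<^sub>R \<omega>)))"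

primrec B_iter ::
  "real ^ 'l \<Rightarrow> ('l torus \<Rightarrow> real ^ 'q ^ 'q) \<Rightarrow> nat \<Rightarrow> 'l torus \<Rightarrow> real ^ 'q ^ 'q" where
  "B_iter \<omega> B 0 = B"
| "B_iter \<omega> B (Suc n) =
     (\<lambda>\<theta>. B_iter \<omega> B n (\<theta> + to_torus (2 ^ n *\<^sub>R \<omega>)) ** B_iter \<omega> B n \<theta>)"

primrec eta_iter ::
  "real ^ 'l \<Rightarrow> ('l torus \<Rightarrow> real ^ 'p ^ 'p) \<Rightarrow> ('l torus \<Rightarrow> real ^ 'q ^ 'q) \<Rightarrow>
   ('l torus \<Rightarrow> real ^ 'q ^ 'p) \<Rightarrow> nat \<Rightarrow> 'l torus \<Rightarrow> real ^ 'q ^ 'p" where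
  "eta_iter \<omega> A B \<eta> 0 = (\<lambda>\<theta>. matrix_inv (A \<theta>) ** \<eta> \<theta>)"
| "eta_iter \<omega> A B \<eta> (Suc n) =
     (\<lambda>\<theta>. eta_iter \<omega> A B \<eta> n \<theta> +
        Ainv_iter \<omega> A n \<theta> ** eta_iter \<omega> A B \<eta> n (\<theta> + to_torus (2 ^ n *\<^sub>R \<omega>))
          ** B_iter \<omega> B n \<theta>)"

definition cohomological_solution ::
  "real ^ 'l \<Rightarrow> ('l torus \<Rightarrow> real ^ 'p ^ 'p) \<Rightarrow> ('l torus \<Rightarrow> real ^ 'q ^ 'q) \<Rightarrow>
   ('l torus \<Rightarrow> real ^ 'q ^ 'p) \<Rightarrow> ('l torus \<Rightarrow> real ^ 'q ^ 'p) \<Rightarrow> bool" where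
  "cohomological_solution \<omega> A B \<eta> \<Delta> \<longleftrightarrow>
     continuous_on UNIV \<Delta> \<and>
     (\<forall>\<theta>. A \<theta> ** \<Delta> \<theta> - \<Delta> (\<theta> + to_torus \<omega>) ** B \<theta> = \<eta> \<theta>)"

end

theory Submission
  imports Defs "HOL-Real_Asymp.Real_Asymp"
begin

text \<open>
  Let \<open>S f \<theta> = A\<inverse>(\<theta>) f(\<theta> + \<omega>) B(\<theta>)\<close>. The equation is the fixed-point problem
  \<open>\<Delta> = \<eta>\<^sub>0 + S \<Delta>\<close> with \<open>\<eta>\<^sub>0 = A\<inverse> \<eta>\<close>, and the recursion is a fast way of summing its
  Neumann series: \<open>Ainv_iter\<close> and \<open>B_iter\<close> are the two outer factors of the power of \<open>S\<close> with
  exponent \<open>2 ^ n\<close> (\<open>iter_sandwich\<close>), so that each step doubles the number of terms, and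
  \<open>\<eta>\<^sub>n\<close> is the sum of \<open>S ^ j \<eta>\<^sub>0\<close> over \<open>j < 2 ^ n\<close> (\<open>eta_iter_eq_partial_sum\<close>).

  Unrolling the fixed-point equation \<open>N\<close> times expresses \<open>\<Delta>\<close> as the \<open>N\<close>-th partial sum plus
  \<open>S ^ N \<Delta>\<close> (\<open>fixpoint_iterate\<close>); at powers of two this is the identity for arbitrary solutions.
  The operator norm is submultiplicative, so \<open>S\<close> contracts the supremum of the operator norms by
  \<open>\<kappa>\<close>, although \<open>A\<inverse>\<close> and \<open>B\<close> separately may be large (\<open>opnorm_transfer_iter_le\<close>). Since the
  torus is compact and \<open>\<eta>\<^sub>0\<close> is continuous, the series converges uniformly by the Weierstrass test,
  and its sum is a continuous fixed point.

  The error is controlled without any estimate of tails: the unrolled identity, applied to the sum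
  \<open>\<Delta>\<close> itself, gives \<open>\<Delta> - \<eta>\<^sub>n = S ^ (2 ^ n) \<Delta>\<close>, which is at most \<open>\<kappa> ^ (2 ^ n)\<close> times the supremum
  of \<open>\<Delta>\<close>. This beats every exponential (\<open>exp_times_double_power_tendsto_0\<close>).
\<close>

section \<open>The torus as a quotient space\<close>

lemma to_torus_add: "to_torus (x + y) = to_torus x + to_torus y"
  by transfer (simp add: torus_rel_def)

lemma continuous_on_to_torus: "continuous_on S to_torus"
  by (rule continuous_on_subset[of UNIV])
    (auto simp: continuous_on_open_vimage open_torus_def)

lemma continuous_on_torus_iff:
  fixes f :: "'l::finite torus \<Rightarrow> 'b::topological_space"
  shows "continuous_on UNIV f \<longleftrightarrow> continuous_on UNIV (\<lambda>x. f (to_torus x))"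
  by (simp add: continuous_on_open_vimage open_torus_def vimage_def)

lemma continuous_on_torus_translate:
  fixes f :: "'l::finite torus \<Rightarrow> 'b::topological_space"
  assumes "continuous_on UNIV f"
  shows "continuous_on UNIV (\<lambda>\<theta>. f (\<theta> + to_torus v))"
proof -
  have "continuous_on UNIV (\<lambda>x. f (to_torus (x + v)))"
    by (rule continuous_on_compose2[OF assms[unfolded continuous_on_torus_iff[of f]]])
      (auto intro: continuous_intros)
  then show ?thesis
    by (simp add: continuous_on_torus_iff[of "\<lambda>\<theta>. f (\<theta> + to_torus v)"] to_torus_add)
qed

text \<open>The componentwise fractional part moves every point into the closed unit cube.\<close>

lemma compact_UNIV_torus: "compact (UNIV :: 'l::finite torus set)"
proof -
  have "\<theta> \<in> to_torus ` cbox 0 1" for \<theta> :: "'l torus"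
  proof -
    have "\<exists>y. y \<in> cbox 0 1 \<and> torus_rel x y" for x :: "real ^ 'l"
      by (rule exI[of _ "\<chi> i. frac (x $ i)"])
        (auto simp: mem_box_cart torus_rel_def frac_def frac_ge_0[unfolded frac_def]
          intro: less_imp_le frac_lt_1[unfolded frac_def])
    then show ?thesis
      unfolding image_iff Bex_def
      by transfer blast
  qed
  then have "(UNIV :: 'l torus set) = to_torus ` cbox 0 1"
    by blast
  then show ?thesis
    using compact_continuous_image[OF continuous_on_to_torus compact_cbox] by metis
qed

section \<open>Matrices: continuity and the operator norm\<close>

lemma tendsto_matrix_mult:
  fixes f :: "'a \<Rightarrow> real ^ 'n ^ 'm" and g :: "'a \<Rightarrow> real ^ 'k ^ 'n"
  assumes "(f \<longlongrightarrow> a) F" "(g \<longlongrightarrow> b) F"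
  shows "((\<lambda>x. f x ** g x) \<longlongrightarrow> a ** b) F"
  unfolding matrix_matrix_mult_def
  by (intro vec_tendstoI) (auto intro!: tendsto_intros assms)

lemma continuous_on_matrix_mult:
  fixes f :: "'a::topological_space \<Rightarrow> real ^ 'n ^ 'm" and g :: "'a \<Rightarrow> real ^ 'k ^ 'n"
  assumes "continuous_on S f" "continuous_on S g"
  shows "continuous_on S (\<lambda>x. f x ** g x)"
  using assms by (auto simp: continuous_on_def intro: tendsto_matrix_mult)

lemma continuous_on_det:
  fixes f :: "'a::topological_space \<Rightarrow> real ^ 'n ^ 'n"
  assumes "continuous_on S f"
  shows "continuous_on S (\<lambda>x. det (f x))"
  unfolding det_def by (intro continuous_intros assms)

lemma matrix_inv_mult:
  fixes M :: "real ^ 'n ^ 'm"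
  assumes "invertible M"
  shows "M ** matrix_inv M = mat 1" and "matrix_inv M ** M = mat 1"
  using someI_ex[OF assms[unfolded invertible_def]] unfolding matrix_inv_def by blast+

text \<open>Cramer's rule writes the entries of the inverse as quotients of determinants.\<close>

lemma matrix_inv_component:
  fixes M :: "real ^ 'n ^ 'n"
  assumes "invertible M"
  shows "matrix_inv M $ k $ j = det (\<chi> i l. if l = k then axis j 1 $ i else M $ i $ l) / det M"
proof -
  have "M *v (matrix_inv M *v axis j 1) = axis j 1"
    by (simp add: matrix_vector_mul_assoc matrix_inv_mult[OF assms])
  then have "matrix_inv M *v axis j 1 =
      (\<chi> k. det (\<chi> i l. if l = k then axis j 1 $ i else M $ i $ l) / det M)"
    using assms by (subst (asm) cramer) (auto simp: invertible_det_nz)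
  moreover have "(matrix_inv M *v axis j 1) $ k = matrix_inv M $ k $ j"
    by (simp add: matrix_vector_mul_component inner_axis)
  ultimately show ?thesis by simp
qed

lemma continuous_on_matrix_inv:
  fixes f :: "'a::topological_space \<Rightarrow> real ^ 'n ^ 'n"
  assumes "continuous_on S f" and "\<And>x. x \<in> S \<Longrightarrow> invertible (f x)"
  shows "continuous_on S (\<lambda>x. matrix_inv (f x))"
proof -
  have entry: "continuous_on S (\<lambda>x. if l = k then axis j 1 $ i else f x $ i $ l)" for i j k l :: 'n
    by (cases "l = k") (auto intro!: continuous_intros assms(1))
  have "continuous_on S (\<lambda>x. matrix_inv (f x) $ k $ j)" for k j
  proof (rule continuous_on_cong[THEN iffD2, OF refl matrix_inv_component])
    show "continuous_on S
        (\<lambda>x. det (\<chi> i l. if l = k then axis j 1 $ i else f x $ i $ l) / det (f x))"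
      using assms(2)
      by (intro continuous_on_divide continuous_on_det assms(1) continuous_on_vec_lambda entry)
        (auto simp: invertible_det_nz)
  qed (use assms(2) in auto)
  then have "continuous_on S (\<lambda>x. \<chi> k j. matrix_inv (f x) $ k $ j)"
    by (intro continuous_on_vec_lambda)
  then show ?thesis by (simp add: vec_lambda_eta)
qed

lemma opnorm_nonneg: "0 \<le> opnorm M"
  unfolding opnorm_def by (rule onorm_pos_le) (rule matrix_vector_mul_bounded_linear)

lemma opnorm_mult_le: "opnorm (M ** N) \<le> opnorm M * opnorm N"
proof -
  have "(*v) (M ** N) = (*v) M \<circ> (*v) N"
    by (auto simp: matrix_vector_mul_assoc)
  then show ?thesis
    unfolding opnorm_def by (simp add: onorm_compose matrix_vector_mul_bounded_linear)
qed

lemma norm_le_opnorm: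
  fixes M :: "real ^ 'n ^ 'm"
  shows "norm M \<le> real CARD('m) * real CARD('n) * opnorm M"
proof -
  have "norm M \<le> (\<Sum>i\<in>UNIV. norm (M $ i))"
    unfolding norm_vec_def by (rule L2_set_le_sum) simp
  also have "\<dots> \<le> (\<Sum>i\<in>(UNIV::'m set). \<Sum>j\<in>(UNIV::'n set). opnorm M)"
    unfolding opnorm_def
    by (intro sum_mono order_trans[OF norm_le_l1_cart] matrix_component_le_onorm)
  finally show ?thesis by simp
qed

lemma opnorm_le_norm:
  fixes M :: "real ^ 'n ^ 'm"
  shows "opnorm M \<le> real CARD('m) * real CARD('n) * norm M"
  unfolding opnorm_def
proof (rule onorm_le_matrix_component)
  fix i j
  show "\<bar>M $ i $ j\<bar> \<le> norm M"
    using component_le_norm_cart[of "M $ i" j] Finite_Cartesian_Product.norm_nth_le[of M i]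
    by linarith
qed

lemma bounded_opnorm_torus:
  fixes f :: "'l::finite torus \<Rightarrow> real ^ 'n ^ 'm"
  assumes "continuous_on UNIV f"
  obtains K where "\<And>\<theta>. opnorm (f \<theta>) \<le> K"
proof -
  have "bounded (range f)"
    by (rule compact_imp_bounded[OF compact_continuous_image[OF assms compact_UNIV_torus]])
  then obtain b where b: "\<And>\<theta>. norm (f \<theta>) \<le> b"
    by (auto simp: bounded_iff)
  have "opnorm (f \<theta>) \<le> real CARD('m) * real CARD('n) * b" for \<theta>
    by (rule order_trans[OF opnorm_le_norm]) (intro mult_left_mono b, simp)
  then show thesis by (rule that)
qed

section \<open>The transfer operator and its powers\<close>

text \<open>The weighted composition operator called \<open>S\<close> above.\<close>

definition transfer ::
  "real ^ 'l \<Rightarrow> ('l torus \<Rightarrow> real ^ 'p ^ 'p) \<Rightarrow> ('l torus \<Rightarrow> real ^ 'q ^ 'q) \<Rightarrow>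
   ('l torus \<Rightarrow> real ^ 'q ^ 'p) \<Rightarrow> 'l torus \<Rightarrow> real ^ 'q ^ 'p" where
  "transfer \<omega> A B f = (\<lambda>\<theta>. matrix_inv (A \<theta>) ** f (\<theta> + to_torus \<omega>) ** B \<theta>)"

lemma transfer_add: "transfer \<omega> A B (\<lambda>\<theta>. f \<theta> + g \<theta>) = (\<lambda>\<theta>. transfer \<omega> A B f \<theta> + transfer \<omega> A B g \<theta>)"
  by (auto simp: transfer_def matrix_matrix_mult_def vec_eq_iff algebra_simps
      sum.distrib sum_distrib_left sum_distrib_right)

lemma transfer_zero: "transfer \<omega> A B (\<lambda>\<theta>. 0) = (\<lambda>\<theta>. 0)"
  by (auto simp: transfer_def matrix_matrix_mult_def vec_eq_iff)

lemma transfer_sum: "transfer \<omega> A B (\<lambda>\<theta>. \<Sum>j<N. f j \<theta>) = (\<lambda>\<theta>. \<Sum>j<(N::nat). transfer \<omega> A B (f j) \<theta>)"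
  by (induction N) (simp_all add: transfer_add transfer_zero)

lemma transfer_iter_sum:
  "(transfer \<omega> A B ^^ m) (\<lambda>\<theta>. \<Sum>j<N. f j \<theta>) = (\<lambda>\<theta>. \<Sum>j<(N::nat). (transfer \<omega> A B ^^ m) (f j) \<theta>)"
  by (induction m) (simp_all add: transfer_sum)

lemma transfer_iter_add:
  "(transfer \<omega> A B ^^ m) (\<lambda>\<theta>. f \<theta> + g \<theta>) =
    (\<lambda>\<theta>. (transfer \<omega> A B ^^ m) f \<theta> + (transfer \<omega> A B ^^ m) g \<theta>)"
  by (induction m) (simp_all add: transfer_add)

text \<open>
  Composing two \<open>2 ^ n\<close>-fold steps evaluates the second pair of factors at \<open>\<theta> + 2 ^ n \<omega>\<close> and puts
  it inside the first pair; this is why the recursions for \<open>Ainv_iter\<close> and \<open>B_iter\<close> multiply in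
  opposite orders.
\<close>

lemma iter_sandwich:
  "Ainv_iter \<omega> A n \<theta> ** f (\<theta> + to_torus (2 ^ n *\<^sub>R \<omega>)) ** B_iter \<omega> B n \<theta> =
    (transfer \<omega> A B ^^ (2 ^ n)) f \<theta>"
proof (induction n arbitrary: f \<theta>)
  case 0
  show ?case by (simp add: transfer_def)
next
  case (Suc n)
  let ?t = "to_torus (2 ^ n *\<^sub>R \<omega>)"
  have double: "to_torus (2 ^ Suc n *\<^sub>R \<omega>) = ?t + ?t"
    by (simp only: power_Suc mult_2 scaleR_add_left to_torus_add)
  have "(transfer \<omega> A B ^^ (2 ^ Suc n)) f \<theta> =
      (transfer \<omega> A B ^^ (2 ^ n)) ((transfer \<omega> A B ^^ (2 ^ n)) f) \<theta>"
    by (simp add: mult_2 funpow_add)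
  also have "\<dots> = Ainv_iter \<omega> A n \<theta> **
      (Ainv_iter \<omega> A n (\<theta> + ?t) ** f (\<theta> + ?t + ?t) ** B_iter \<omega> B n (\<theta> + ?t)) ** B_iter \<omega> B n \<theta>"
    by (simp only: Suc.IH)
  finally show ?case
    by (simp only: Ainv_iter.simps B_iter.simps double matrix_mul_assoc add.assoc)
qed

lemma eta_iter_eq_partial_sum:
  fixes \<eta> :: "'l::finite torus \<Rightarrow> real ^ 'b ^ 'a"
  shows "eta_iter \<omega> A B \<eta> n =
    (\<lambda>\<theta>. \<Sum>j<2 ^ n. (transfer \<omega> A B ^^ j) (\<lambda>\<theta>. matrix_inv (A \<theta>) ** \<eta> \<theta>) \<theta>)"
proof (induction n)
  case 0
  show ?case by simp
next
  case (Suc n)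
  let ?\<eta>0 = "\<lambda>\<theta>. matrix_inv (A \<theta>) ** \<eta> \<theta>"
  have split: "(\<Sum>j<m + k. f j) = (\<Sum>j<m. f j) + (\<Sum>j<k. f (m + j))"
    for m k and f :: "nat \<Rightarrow> real ^ 'b ^ 'a"
    by (induction k) (simp_all add: add.assoc)
  have "eta_iter \<omega> A B \<eta> (Suc n) \<theta> =
      (\<Sum>j<2 ^ Suc n. (transfer \<omega> A B ^^ j) ?\<eta>0 \<theta>)" for \<theta>
  proof -
    have "eta_iter \<omega> A B \<eta> (Suc n) \<theta> =
        eta_iter \<omega> A B \<eta> n \<theta> + (transfer \<omega> A B ^^ (2 ^ n)) (eta_iter \<omega> A B \<eta> n) \<theta>"
      by (simp add: iter_sandwich)
    also have "\<dots> = (\<Sum>j<2 ^ n. (transfer \<omega> A B ^^ j) ?\<eta>0 \<theta>) +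
        (\<Sum>j<2 ^ n. (transfer \<omega> A B ^^ (2 ^ n + j)) ?\<eta>0 \<theta>)"
      by (simp add: Suc.IH transfer_iter_sum funpow_add)
    also have "\<dots> = (\<Sum>j<2 ^ n + 2 ^ n. (transfer \<omega> A B ^^ j) ?\<eta>0 \<theta>)"
      by (rule split[symmetric])
    finally show ?thesis by (simp add: mult_2)
  qed
  then show ?case by blast
qed

lemma fixpoint_iterate:
  assumes "\<And>\<theta>. \<Delta> \<theta> = f \<theta> + transfer \<omega> A B \<Delta> \<theta>"
  shows "\<Delta> \<theta> = (\<Sum>j<N. (transfer \<omega> A B ^^ j) f \<theta>) + (transfer \<omega> A B ^^ N) \<Delta> \<theta>"
proof (induction N)
  case 0
  show ?case by simp
next
  case (Suc N)
  have "\<Delta> = (\<lambda>\<theta>. f \<theta> + transfer \<omega> A B \<Delta> \<theta>)"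
    using assms by blast
  then have "(transfer \<omega> A B ^^ N) \<Delta> \<theta> =
      (transfer \<omega> A B ^^ N) (\<lambda>\<theta>. f \<theta> + transfer \<omega> A B \<Delta> \<theta>) \<theta>"
    by (rule arg_cong)
  then show ?case
    using Suc.IH by (simp add: transfer_iter_add funpow_swap1 add.assoc)
qed

lemma solution_iff_fixpoint:
  assumes "invertible (A \<theta>)"
  shows "A \<theta> ** \<Delta> \<theta> - \<Delta> (\<theta> + to_torus \<omega>) ** B \<theta> = \<eta> \<theta> \<longleftrightarrow>
    \<Delta> \<theta> = matrix_inv (A \<theta>) ** \<eta> \<theta> + transfer \<omega> A B \<Delta> \<theta>" (is "?L \<longleftrightarrow> ?R")
proof
  assume ?L
  then have "A \<theta> ** \<Delta> \<theta> = \<eta> \<theta> + \<Delta> (\<theta> + to_torus \<omega>) ** B \<theta>"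
    by (simp add: algebra_simps)
  then have "matrix_inv (A \<theta>) ** (A \<theta> ** \<Delta> \<theta>) =
      matrix_inv (A \<theta>) ** (\<eta> \<theta> + \<Delta> (\<theta> + to_torus \<omega>) ** B \<theta>)"
    by simp
  then show ?R
    by (simp add: matrix_mul_assoc matrix_inv_mult[OF assms] matrix_add_ldistrib transfer_def)
next
  assume ?R
  then have "A \<theta> ** \<Delta> \<theta> = A \<theta> ** (matrix_inv (A \<theta>) ** \<eta> \<theta> + transfer \<omega> A B \<Delta> \<theta>)"
    by simp
  then show ?L
    by (simp add: matrix_mul_assoc matrix_inv_mult[OF assms] matrix_add_ldistrib transfer_def)
qed

text \<open>
  In one application of the operator both outer factors are evaluated at the same point, so a bound
  on the product of their norms suffices.
\<close>

lemma opnorm_transfer_iter_le: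
  assumes "\<And>\<theta>. opnorm (matrix_inv (A \<theta>)) * opnorm (B \<theta>) \<le> \<kappa>" and "\<And>\<theta>. opnorm (f \<theta>) \<le> K"
  shows "opnorm ((transfer \<omega> A B ^^ N) f \<theta>) \<le> \<kappa> ^ N * K"
proof (induction N arbitrary: \<theta>)
  case 0
  show ?case using assms(2) by simp
next
  case (Suc N)
  let ?g = "(transfer \<omega> A B ^^ N) f (\<theta> + to_torus \<omega>)"
  have "opnorm ((transfer \<omega> A B ^^ Suc N) f \<theta>) = opnorm (matrix_inv (A \<theta>) ** ?g ** B \<theta>)"
    by (simp add: transfer_def)
  also have "\<dots> \<le> opnorm (matrix_inv (A \<theta>) ** ?g) * opnorm (B \<theta>)"
    by (rule opnorm_mult_le)
  also have "\<dots> \<le> opnorm (matrix_inv (A \<theta>)) * opnorm ?g * opnorm (B \<theta>)"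
    by (intro mult_right_mono opnorm_mult_le opnorm_nonneg)
  also have "\<dots> = (opnorm (matrix_inv (A \<theta>)) * opnorm (B \<theta>)) * opnorm ?g"
    by simp
  also have "\<dots> \<le> \<kappa> * (\<kappa> ^ N * K)"
    using order_trans[OF _ assms(1)]
    by (intro mult_mono assms(1) Suc.IH) (auto simp: opnorm_nonneg)
  finally show ?case by (simp add: mult.assoc)
qed

lemma continuous_on_transfer_iter:
  assumes "continuous_on UNIV (\<lambda>\<theta>. matrix_inv (A \<theta>))" "continuous_on UNIV B" "continuous_on UNIV f"
  shows "continuous_on UNIV ((transfer \<omega> A B ^^ N) f)"
  by (induction N)
    (auto simp: transfer_def
      intro!: continuous_on_matrix_mult continuous_on_torus_translate assms)

section \<open>Double exponential decay\<close>

lemma exp_times_double_power_tendsto_0: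
  fixes \<kappa> c :: real
  assumes "0 \<le> \<kappa>" "\<kappa> < 1"
  shows "(\<lambda>n. exp (c * real n) * \<kappa> ^ (2 ^ n)) \<longlonglongrightarrow> 0"
proof (cases "\<kappa> = 0")
  case True
  then show ?thesis by (simp add: power_0_left)
next
  case False
  define d where "d = - ln \<kappa>"
  have d: "d > 0" and \<kappa>: "\<kappa> = exp (- d)"
    using assms False by (auto simp: d_def)
  have "(\<lambda>n. exp (c * real n) * \<kappa> ^ (2 ^ n)) = (\<lambda>n. exp (c * real n - d * 2 ^ n))"
    by (auto simp: \<kappa> exp_diff exp_minus field_simps simp flip: exp_of_nat_mult)
  moreover have "(\<lambda>n::nat. exp (c * real n - d * 2 ^ n)) \<longlonglongrightarrow> 0"
    using d by real_asymp
  ultimately show ?thesis by simp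
qed

section \<open>Existence and approximation of the solution\<close>

theorem mainTheorem1:
  fixes \<omega> :: "real ^ 'l"
    and A :: "'l torus \<Rightarrow> real ^ 'p ^ 'p"
    and B :: "'l torus \<Rightarrow> real ^ 'q ^ 'q"
    and \<eta> :: "'l torus \<Rightarrow> real ^ 'q ^ 'p"
    and \<kappa> :: real
  assumes "continuous_on UNIV A" and "\<And>\<theta>. invertible (A \<theta>)"
    and "continuous_on UNIV B"
    and "continuous_on UNIV \<eta>"
    and "\<kappa> < 1"
    and "\<And>\<theta>. opnorm (matrix_inv (A \<theta>)) * opnorm (B \<theta>) \<le> \<kappa>"
  shows "(\<forall>\<Delta>. cohomological_solution \<omega> A B \<eta> \<Delta> \<longrightarrow>
            (\<forall>n \<theta>. \<Delta> \<theta> = eta_iter \<omega> A B \<eta> (Suc n) \<theta> +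
               Ainv_iter \<omega> A (Suc n) \<theta> ** \<Delta> (\<theta> + to_torus (2 ^ Suc n *\<^sub>R \<omega>))
                 ** B_iter \<omega> B (Suc n) \<theta>)) \<and>
         uniformly_convergent_on UNIV (eta_iter \<omega> A B \<eta>) \<and>
         (let \<Delta> = (\<lambda>\<theta>. lim (\<lambda>n. eta_iter \<omega> A B \<eta> n \<theta>)) in
            cohomological_solution \<omega> A B \<eta> \<Delta> \<and>
            (\<forall>c>0. (\<lambda>n. exp (c * real n) * (SUP \<theta>. opnorm (\<Delta> \<theta> - eta_iter \<omega> A B \<eta> n \<theta>)))
                      \<longlonglongrightarrow> 0))"
proof -
  let ?\<eta>0 = "\<lambda>\<theta>. matrix_inv (A \<theta>) ** \<eta> \<theta>"
  let ?S = "transfer \<omega> A B"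
  define D where "D = (\<lambda>\<theta>. \<Sum>j. (?S ^^ j) ?\<eta>0 \<theta>)"

  have "0 \<le> opnorm (matrix_inv (A 0)) * opnorm (B 0)"
    by (simp add: opnorm_nonneg)
  then have \<kappa>0: "0 \<le> \<kappa>"
    using assms(6)[of 0] by linarith
  have cinv: "continuous_on UNIV (\<lambda>\<theta>. matrix_inv (A \<theta>))"
    by (rule continuous_on_matrix_inv) (use assms(1,2) in auto)
  have c\<eta>0: "continuous_on UNIV ?\<eta>0"
    by (intro continuous_on_matrix_mult cinv assms(4))
  obtain K where K: "\<And>\<theta>. opnorm (?\<eta>0 \<theta>) \<le> K"
    using bounded_opnorm_torus[OF c\<eta>0] by blast

  have lim_series: "uniform_limit UNIV (\<lambda>N \<theta>. \<Sum>j<N. (?S ^^ j) ?\<eta>0 \<theta>) D sequentially"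
    unfolding D_def
  proof (rule Weierstrass_m_test)
    \<comment> \<open>The Weierstrass test needs the norm of the matrix space, comparable to the operator norm
      up to this constant.\<close>
    let ?C = "real CARD('p) * real CARD('q)"
    show "norm ((?S ^^ j) ?\<eta>0 \<theta>) \<le> ?C * (\<kappa> ^ j * K)" for j \<theta>
      by (rule order_trans[OF norm_le_opnorm])
        (intro mult_left_mono opnorm_transfer_iter_le assms(6) K, simp)
    show "summable (\<lambda>j. ?C * (\<kappa> ^ j * K))"
      using \<kappa>0 assms(5) by (intro summable_mult summable_mult2 summable_geometric) simp
  qed
  have lim_eta: "uniform_limit UNIV (eta_iter \<omega> A B \<eta>) D sequentially"
  proof -
    have "filterlim (\<lambda>n::nat. (2::nat) ^ n) sequentially sequentially"
      by (rule filterlim_subseq) (simp add: strict_mono_def)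
    from filterlim_compose[OF lim_series this] show ?thesis
      by (simp add: eta_iter_eq_partial_sum[abs_def])
  qed

  have cD: "continuous_on UNIV D"
    by (rule uniform_limit_theorem[OF _ lim_series])
      (auto intro!: always_eventually continuous_on_sum continuous_on_transfer_iter
        cinv assms(3) c\<eta>0)
  \<comment> \<open>Pass to the limit in the recursion of the partial sums, \<open>s (N + 1) = \<eta>\<^sub>0 + S (s N)\<close>.\<close>
  have fixD: "D \<theta> = ?\<eta>0 \<theta> + ?S D \<theta>" for \<theta>
  proof -
    have ptw: "(\<lambda>N. \<Sum>j<N. (?S ^^ j) ?\<eta>0 \<theta>) \<longlonglongrightarrow> D \<theta>" for \<theta>
      using tendsto_uniform_limitI[OF lim_series] by simp
    have "(\<lambda>N. ?\<eta>0 \<theta> + ?S (\<lambda>\<theta>. \<Sum>j<N. (?S ^^ j) ?\<eta>0 \<theta>) \<theta>) \<longlonglongrightarrow> ?\<eta>0 \<theta> + ?S D \<theta>"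
      unfolding transfer_def[of _ _ _ D] transfer_def[of _ _ _ "\<lambda>\<theta>. \<Sum>j<_. _ j \<theta>"]
      by (intro tendsto_intros tendsto_matrix_mult ptw)
    moreover have "?\<eta>0 \<theta> + ?S (\<lambda>\<theta>. \<Sum>j<N. (?S ^^ j) ?\<eta>0 \<theta>) \<theta> =
        (\<Sum>j<Suc N. (?S ^^ j) ?\<eta>0 \<theta>)" for N
      by (subst sum.lessThan_Suc_shift) (simp add: transfer_sum)
    ultimately show ?thesis
      using LIMSEQ_unique[OF LIMSEQ_Suc[OF ptw]] by simp
  qed
  have solD: "cohomological_solution \<omega> A B \<eta> D"
    unfolding cohomological_solution_def solution_iff_fixpoint[where A = A, OF assms(2)]
    using cD fixD by blast

  have limD: "(\<lambda>\<theta>. lim (\<lambda>n. eta_iter \<omega> A B \<eta> n \<theta>)) = D"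
    using tendsto_uniform_limitI[OF lim_eta] by (auto intro!: limI)

  have unrolled: "\<Delta> \<theta> = eta_iter \<omega> A B \<eta> n \<theta> +
      Ainv_iter \<omega> A n \<theta> ** \<Delta> (\<theta> + to_torus (2 ^ n *\<^sub>R \<omega>)) ** B_iter \<omega> B n \<theta>"
    if "cohomological_solution \<omega> A B \<eta> \<Delta>" for \<Delta> n \<theta>
  proof -
    have "\<Delta> \<theta> = ?\<eta>0 \<theta> + ?S \<Delta> \<theta>" for \<theta>
      using that solution_iff_fixpoint[where A = A, OF assms(2)]
      unfolding cohomological_solution_def by blast
    from fixpoint_iterate[OF this, of \<theta> "2 ^ n"] show ?thesis
      unfolding iter_sandwich eta_iter_eq_partial_sum .
  qed

  have decay: "(\<lambda>n. exp (c * real n) * (SUP \<theta>. opnorm (D \<theta> - eta_iter \<omega> A B \<eta> n \<theta>))) \<longlonglongrightarrow> 0" for c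
  proof -
    obtain L where L: "\<And>\<theta>. opnorm (D \<theta>) \<le> L"
      using bounded_opnorm_torus[OF cD] by blast
    have tail: "D \<theta> - eta_iter \<omega> A B \<eta> n \<theta> = (?S ^^ (2 ^ n)) D \<theta>" for n \<theta>
      using unrolled[OF solD, of \<theta> n] unfolding iter_sandwich by (simp add: algebra_simps)
    have le: "opnorm (D \<theta> - eta_iter \<omega> A B \<eta> n \<theta>) \<le> \<kappa> ^ (2 ^ n) * L" for n \<theta>
      unfolding tail by (intro opnorm_transfer_iter_le assms(6) L)
    have sup_le: "(SUP \<theta>. opnorm (D \<theta> - eta_iter \<omega> A B \<eta> n \<theta>)) \<le> \<kappa> ^ (2 ^ n) * L" for n
      by (rule cSUP_least) (auto intro: le)
    have sup_ge: "0 \<le> (SUP \<theta>. opnorm (D \<theta> - eta_iter \<omega> A B \<eta> n \<theta>))" for n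
      by (rule cSUP_upper2[where x = 0]) (auto intro!: bdd_aboveI2 le simp: opnorm_nonneg)
    show ?thesis
    proof (rule tendsto_sandwich[OF always_eventually always_eventually tendsto_const])
      show "(\<lambda>n. exp (c * real n) * \<kappa> ^ (2 ^ n) * L) \<longlonglongrightarrow> 0"
        by (intro tendsto_mult_left_zero exp_times_double_power_tendsto_0 \<kappa>0 assms(5))
      show "\<forall>n. 0 \<le> exp (c * real n) * (SUP \<theta>. opnorm (D \<theta> - eta_iter \<omega> A B \<eta> n \<theta>))"
        by (intro allI mult_nonneg_nonneg sup_ge) simp
      show "\<forall>n. exp (c * real n) * (SUP \<theta>. opnorm (D \<theta> - eta_iter \<omega> A B \<eta> n \<theta>))
          \<le> exp (c * real n) * \<kappa> ^ (2 ^ n) * L"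
        unfolding mult.assoc by (intro allI mult_left_mono sup_le) simp
    qed
  qed

  show ?thesis
    unfolding Let_def limD
  proof (intro conjI allI impI)
    show "uniformly_convergent_on UNIV (eta_iter \<omega> A B \<eta>)"
      using lim_eta by (rule uniformly_convergentI)
  qed (rule unrolled solD decay | assumption)+
qed

end
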